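(* (1) The weakly increasing rearrangement statistic $\mathrm{sort}{\uparrow}$ is weakly shuffle-compatible on parking functions. (2) The linear map on $\mathcal{A}^{\mathrm{PF}}_{\mathrm{sort}\uparrow}$ defined by $[\alpha]^{\mathrm{PF}}_{\mathrm{sort}\uparrow}\mapsto\frac{1}{|\alpha|!}\mathbf{P}_{\mathrm{sort}\uparrow(\alpha)}$ is an algebra isomorphism between $\mathcal{A}^{\mathrm{PF}}_{\mathrm{sort}\uparrow}$ and $\mathrm{CQSym}$.
   Context: All algebras are over $\mathbb{Q}$. A parking function of length $n\ge0$ is a sequence $\alpha=(\alpha_1,\dots,\alpha_n)$ of positive integers whose weakly increasing rearrangement $\alpha'_1\le\dots\le\alpha'_n$ satisfies $\alpha'_i\le i$; $|\alpha|=n$. $\mathrm{PF}_n$ is the set of these and $\mathrm{PF}=\bigcup_{n\ge0}\mathrm{PF}_n$. The statistic is $\mathrm{sort}{\uparrow}(\alpha)=(\alpha'_1,\dots,\alpha'_n)$. For $\alpha\in\mathrm{PF}_n,\beta\in\mathrm{PF}_m$, let $\beta[n]=(\beta_1+n,\dots,\beta_m+n)$; the shifted shuffle $\overrightarrow{\mathrm{Sh}}(\alpha,\beta)$ is the set of all interleavings (shuffles) of $\alpha$ and $\beta[n]$. A statistic $\mathrm{st}$ on $\mathrm{PF}$ is weakly shuffle-compatible on parking functions if for all $\alpha,\beta\in\mathrm{PF}$ the multiset $\{\{\mathrm{st}(\gamma):\gamma\in\overrightarrow{\mathrm{Sh}}(\alpha,\beta)\}\}$ is determined by $|\alpha|,|\beta|,\mathrm{st}(\alpha),\mathrm{st}(\beta)$.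 Let $[\alpha]^{\mathrm{PF}}_{\mathrm{st}}=\{\beta\in\mathrm{PF}:\mathrm{st}(\beta)=\mathrm{st}(\alpha),|\beta|=|\alpha|\}$. $\mathcal{A}^{\mathrm{PF}}_{\mathrm{st}}$ is the algebra with basis these classes and product $[\alpha]^{\mathrm{PF}}_{\mathrm{st}}[\beta]^{\mathrm{PF}}_{\mathrm{st}}=\sum_{\gamma\in\overrightarrow{\mathrm{Sh}}(\alpha,\beta)}[\gamma]^{\mathrm{PF}}_{\mathrm{st}}$. $\mathrm{CQSym}$ (Catalan quasisymmetric functions) is the algebra with basis $\{\mathbf{P}_\alpha\}$ indexed by weakly increasing parking functions $\alpha$ and product $\mathbf{P}_\alpha\mathbf{P}_\beta=\mathbf{P}_{\alpha\cdot\beta[n]}$ for $\alpha$ of length $n$, where $\cdot$ is concatenation. *)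

theory Defs
  imports "HOL-Library.Multiset" "HOL-Library.Poly_Mapping"
    "HOL-Algebra.Algebraic_Closure_Type"
begin

section \<open>Parking functions and shifted shuffles\<close>

definition PF :: "nat list set" where
  "PF = {\<alpha>. (\<forall>a\<in>set \<alpha>. 1 \<le> a) \<and> (\<forall>i<length \<alpha>. sort \<alpha> ! i \<le> i + 1)}"

definition shift :: "nat \<Rightarrow> nat list \<Rightarrow> nat list" where
  "shift n \<beta> = map (\<lambda>b. b + n) \<beta>"

text \<open>For parking functions the letters of \<open>\<alpha>\<close> and of the shifted \<open>\<beta>\<close> are disjoint, so
  different interleavings are different words and a set of words loses no multiplicity.\<close>

definition shifted_shuffles :: "nat list \<Rightarrow> nat list \<Rightarrow> nat list set" where
  "shifted_shuffles \<alpha> \<beta> = shuffles \<alpha> (shift (length \<alpha>) \<beta>)"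

definition weakly_shuffle_compatible :: "(nat list \<Rightarrow> 'b) \<Rightarrow> bool" where
  "weakly_shuffle_compatible st \<longleftrightarrow>
    (\<forall>\<alpha>\<in>PF. \<forall>\<beta>\<in>PF. \<forall>\<alpha>'\<in>PF. \<forall>\<beta>'\<in>PF.
      length \<alpha> = length \<alpha>' \<and> length \<beta> = length \<beta>' \<and> st \<alpha> = st \<alpha>' \<and> st \<beta> = st \<beta>' \<longrightarrow>
      image_mset st (mset_set (shifted_shuffles \<alpha> \<beta>)) =
      image_mset st (mset_set (shifted_shuffles \<alpha>' \<beta>')))"

section \<open>Algebras over the rationals\<close>

text \<open>The library's locale \<^locale>\<open>algebra\<close> requires commutativity, which fails for the
  algebras considered here.\<close>

abbreviation rat_ring :: "rat ring" where
  "rat_ring \<equiv> ring_of_type_algebra"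

definition rat_algebra :: "(rat, 'a) module \<Rightarrow> bool" where
  "rat_algebra A \<longleftrightarrow> Module.module rat_ring A \<and> Ring.ring A \<and>
    (\<forall>c. \<forall>x\<in>carrier A. \<forall>y\<in>carrier A.
      (c \<odot>\<^bsub>A\<^esub> x) \<otimes>\<^bsub>A\<^esub> y = c \<odot>\<^bsub>A\<^esub> (x \<otimes>\<^bsub>A\<^esub> y) \<and>
      x \<otimes>\<^bsub>A\<^esub> (c \<odot>\<^bsub>A\<^esub> y) = c \<odot>\<^bsub>A\<^esub> (x \<otimes>\<^bsub>A\<^esub> y))"

definition rat_linear :: "(rat, 'a) module \<Rightarrow> (rat, 'b) module \<Rightarrow> ('a \<Rightarrow> 'b) \<Rightarrow> bool" where
  "rat_linear A B f \<longleftrightarrow> f \<in> carrier A \<rightarrow> carrier B \<and>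
    (\<forall>x\<in>carrier A. \<forall>y\<in>carrier A. f (x \<oplus>\<^bsub>A\<^esub> y) = f x \<oplus>\<^bsub>B\<^esub> f y) \<and>
    (\<forall>c. \<forall>x\<in>carrier A. f (c \<odot>\<^bsub>A\<^esub> x) = c \<odot>\<^bsub>B\<^esub> f x)"

definition rat_algebra_iso :: "(rat, 'a) module \<Rightarrow> (rat, 'b) module \<Rightarrow> ('a \<Rightarrow> 'b) \<Rightarrow> bool" where
  "rat_algebra_iso A B f \<longleftrightarrow>
    rat_algebra A \<and> rat_algebra B \<and> rat_linear A B f \<and> f \<in> ring_iso A B"

text \<open>The free rational vector space on \<open>I\<close>, with the bilinear multiplication given on basis
  vectors by \<open>p\<close> and with the basis vector \<open>e\<close> as unit. Nothing here asserts that the result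
  is an algebra.\<close>

definition rat_scale :: "rat \<Rightarrow> ('k \<Rightarrow>\<^sub>0 rat) \<Rightarrow> 'k \<Rightarrow>\<^sub>0 rat" where
  "rat_scale c x = Poly_Mapping.map ((*) c) x"

definition based_algebra ::
  "'k set \<Rightarrow> ('k \<Rightarrow> 'k \<Rightarrow> ('k \<Rightarrow>\<^sub>0 rat)) \<Rightarrow> 'k \<Rightarrow> (rat, 'k \<Rightarrow>\<^sub>0 rat) module" where
  "based_algebra I p e =
    \<lparr>carrier = {x. Poly_Mapping.keys x \<subseteq> I},
     monoid.mult = (\<lambda>x y. \<Sum>a\<in>Poly_Mapping.keys x. \<Sum>b\<in>Poly_Mapping.keys y.
       rat_scale (Poly_Mapping.lookup x a * Poly_Mapping.lookup y b) (p a b)),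
     one = Poly_Mapping.single e 1,
     ring.zero = 0,
     add = (+),
     module.smult = rat_scale\<rparr>"

section \<open>The algebra of a statistic\<close>

definition PF_class :: "(nat list \<Rightarrow> 'b) \<Rightarrow> nat list \<Rightarrow> nat list set" where
  "PF_class st \<alpha> = {\<beta>\<in>PF. st \<beta> = st \<alpha> \<and> length \<beta> = length \<alpha>}"

definition PF_basis :: "(nat list \<Rightarrow> 'b) \<Rightarrow> nat list \<Rightarrow> nat list set \<Rightarrow>\<^sub>0 rat" where
  "PF_basis st \<alpha> = Poly_Mapping.single (PF_class st \<alpha>) 1"

text \<open>The product of two classes is computed on chosen representatives; by
  \<open>PF_algebra_mult_basis\<close> below the choice is irrelevant for a weakly shuffle-compatible
  statistic.\<close>

definition PF_algebra :: "(nat list \<Rightarrow> 'b) \<Rightarrow> (rat, nat list set \<Rightarrow>\<^sub>0 rat) module" where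
  "PF_algebra st = based_algebra (PF_class st ` PF)
    (\<lambda>C D. \<Sum>\<gamma>\<in>shifted_shuffles (SOME \<alpha>. \<alpha> \<in> C) (SOME \<beta>. \<beta> \<in> D). PF_basis st \<gamma>)
    (PF_class st [])"

lemma rat_scale_one: "rat_scale 1 x = x"
  unfolding rat_scale_def
  by (rule poly_mapping_eqI) (simp add: Poly_Mapping.map.rep_eq when_def)

lemma PF_algebra_mult_basis:
  assumes "weakly_shuffle_compatible st" "\<alpha> \<in> PF" "\<beta> \<in> PF"
  shows "PF_basis st \<alpha> \<otimes>\<^bsub>PF_algebra st\<^esub> PF_basis st \<beta> =
    (\<Sum>\<gamma>\<in>shifted_shuffles \<alpha> \<beta>. PF_basis st \<gamma>)"
proof -
  define \<alpha>' where "\<alpha>' = (SOME a. a \<in> PF_class st \<alpha>)"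
  define \<beta>' where "\<beta>' = (SOME b. b \<in> PF_class st \<beta>)"
  have a: "\<alpha>' \<in> PF_class st \<alpha>" unfolding \<alpha>'_def
    by (rule someI[of _ \<alpha>]) (use assms in \<open>simp add: PF_class_def\<close>)
  have b: "\<beta>' \<in> PF_class st \<beta>" unfolding \<beta>'_def
    by (rule someI[of _ \<beta>]) (use assms in \<open>simp add: PF_class_def\<close>)
  have len: "length \<gamma> = length x + length y" if "\<gamma> \<in> shifted_shuffles x y" for \<gamma> x y
    using that by (simp add: shifted_shuffles_def shift_def length_shuffles)
  define F where "F n s = Poly_Mapping.single {\<beta>\<in>PF. st \<beta> = s \<and> length \<beta> = n} (1::rat)"
    for n s
  have sum: "(\<Sum>\<gamma>\<in>shifted_shuffles x y. PF_basis st \<gamma>) =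
      sum_mset (image_mset (F (length x + length y))
        (image_mset st (mset_set (shifted_shuffles x y))))" for x y
  proof -
    have "(\<Sum>\<gamma>\<in>shifted_shuffles x y. PF_basis st \<gamma>) =
      (\<Sum>\<gamma>\<in>shifted_shuffles x y. F (length x + length y) (st \<gamma>))"
      by (rule sum.cong) (auto simp: PF_basis_def PF_class_def F_def dest: len)
    then show ?thesis
      by (simp add: sum_unfold_sum_mset image_mset.compositionality comp_def)
  qed
  have "PF_basis st \<alpha> \<otimes>\<^bsub>PF_algebra st\<^esub> PF_basis st \<beta> =
      (\<Sum>\<gamma>\<in>shifted_shuffles \<alpha>' \<beta>'. PF_basis st \<gamma>)"
    by (simp add: PF_algebra_def based_algebra_def PF_basis_def[of st \<alpha>] PF_basis_def[of st \<beta>]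
        rat_scale_one \<alpha>'_def[symmetric] \<beta>'_def[symmetric])
  moreover have "image_mset st (mset_set (shifted_shuffles \<alpha>' \<beta>')) =
      image_mset st (mset_set (shifted_shuffles \<alpha> \<beta>))"
    using assms a b unfolding weakly_shuffle_compatible_def PF_class_def by blast
  moreover have "length \<alpha>' = length \<alpha>" "length \<beta>' = length \<beta>"
    using a b by (simp_all add: PF_class_def)
  ultimately show ?thesis by (simp add: sum)
qed

section \<open>Catalan quasisymmetric functions\<close>

definition CQ_basis :: "nat list \<Rightarrow> nat list \<Rightarrow>\<^sub>0 rat" where
  "CQ_basis \<alpha> = Poly_Mapping.single \<alpha> 1"

definition CQSym :: "(rat, nat list \<Rightarrow>\<^sub>0 rat) module" where
  "CQSym = based_algebra {\<alpha>\<in>PF. sorted \<alpha>}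
    (\<lambda>\<alpha> \<beta>. CQ_basis (\<alpha> @ shift (length \<alpha>) \<beta>)) []"

end

theory Submission
  imports Defs
begin

text \<open>The letters of a parking function \<open>\<alpha>\<close> of length \<open>n\<close> are at most \<open>n\<close>, so each shifted
  shuffle of \<open>\<alpha>\<close> and \<open>\<beta>\<close> sorts to \<open>sort \<alpha>\<close> followed by the shifted \<open>sort \<beta>\<close>, and there
  are \<open>(n + m)! / (n! m!)\<close> of them, where \<open>m\<close> is the length of \<open>\<beta>\<close>. The product of two
  classes is therefore this multiple of a single class, and dividing each class by the factorial of its length turns
  the product into that of \<open>CQSym\<close>.\<close>

section \<open>Linear extension of maps on basis vectors\<close>

lemma lookup_rat_scale [simp]:
  "Poly_Mapping.lookup (rat_scale c x) k = c * Poly_Mapping.lookup x k"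
  by (simp add: rat_scale_def Poly_Mapping.map.rep_eq when_def)

lemma rat_scale_add: "rat_scale c (x + y) = rat_scale c x + rat_scale c y"
  by (rule poly_mapping_eqI) (simp add: lookup_add algebra_simps)

lemma rat_scale_add_left: "rat_scale (c + d) x = rat_scale c x + rat_scale d x"
  by (rule poly_mapping_eqI) (simp add: lookup_add algebra_simps)

lemma rat_scale_rat_scale [simp]: "rat_scale c (rat_scale d x) = rat_scale (c * d) x"
  by (rule poly_mapping_eqI) (simp add: mult.assoc)

lemma rat_scale_zero [simp]: "rat_scale 0 x = 0" "rat_scale c 0 = 0"
  by (rule poly_mapping_eqI, simp)+

lemma rat_scale_single [simp]:
  "rat_scale c (Poly_Mapping.single k d) = Poly_Mapping.single k (c * d)"
  by (rule poly_mapping_eqI) (simp add: lookup_single when_def)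

lemma rat_scale_sum: "rat_scale c (sum f A) = (\<Sum>a\<in>A. rat_scale c (f a))"
  by (rule poly_mapping_eqI) (simp add: lookup_sum sum_distrib_left)

lemma keys_rat_scale: "Poly_Mapping.keys (rat_scale c x) \<subseteq> Poly_Mapping.keys x"
  by (auto simp: in_keys_iff)

text \<open>Both the product of a based algebra and the maps between such algebras are instances.
  Only the values of \<open>\<phi>\<close> on the support matter, so \<open>\<phi>\<close> may be
  arbitrary off the chosen basis.\<close>

definition linear_extension ::
  "('k \<Rightarrow> 'l \<Rightarrow>\<^sub>0 rat) \<Rightarrow> ('k \<Rightarrow>\<^sub>0 rat) \<Rightarrow> 'l \<Rightarrow>\<^sub>0 rat" where
  "linear_extension \<phi> x =
    (\<Sum>a\<in>Poly_Mapping.keys x. rat_scale (Poly_Mapping.lookup x a) (\<phi> a))"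

lemma linear_extension_single [simp]:
  "linear_extension \<phi> (Poly_Mapping.single a c) = rat_scale c (\<phi> a)"
  by (simp add: linear_extension_def)

lemma linear_extension_add:
  "linear_extension \<phi> (x + y) = linear_extension \<phi> x + linear_extension \<phi> y"
  unfolding linear_extension_def
  by (rule setsum_keys_plus_distrib) (simp_all add: rat_scale_add_left)

lemma linear_extension_scale:
  "linear_extension \<phi> (rat_scale c x) = rat_scale c (linear_extension \<phi> x)"
proof -
  \<comment> \<open>For c = 0 the support collapses, so the sum is first extended to all keys of x,
    where the extra terms vanish.\<close>
  have "linear_extension \<phi> (rat_scale c x) =
      (\<Sum>a\<in>Poly_Mapping.keys x. rat_scale (Poly_Mapping.lookup (rat_scale c x) a) (\<phi> a))"
    unfolding linear_extension_def using keys_rat_scale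
    by (intro sum.mono_neutral_left) (auto simp: in_keys_iff)
  then show ?thesis by (simp add: linear_extension_def rat_scale_sum)
qed

text \<open>Linearity in the extended function gives linearity of a product in its second factor,
  which sits inside that function.\<close>

lemma linear_extension_add_fun:
  "linear_extension (\<lambda>a. \<phi> a + \<psi> a) x = linear_extension \<phi> x + linear_extension \<psi> x"
  by (simp add: linear_extension_def rat_scale_add sum.distrib)

lemma linear_extension_zero [simp]:
  "linear_extension \<phi> 0 = 0" "linear_extension (\<lambda>_. 0) x = 0"
  by (simp_all add: linear_extension_def)

lemma linear_extension_scale_fun:
  "linear_extension (\<lambda>a. rat_scale c (\<phi> a)) x = rat_scale c (linear_extension \<phi> x)"
  by (simp add: linear_extension_def rat_scale_sum mult.commute)

lemma keys_linear_extension: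
  assumes "Poly_Mapping.keys x \<subseteq> I" "\<And>a. a \<in> I \<Longrightarrow> Poly_Mapping.keys (\<phi> a) \<subseteq> J"
  shows "Poly_Mapping.keys (linear_extension \<phi> x) \<subseteq> J"
proof -
  have "Poly_Mapping.keys (rat_scale c (\<phi> a)) \<subseteq> J" if "a \<in> Poly_Mapping.keys x" for a c
    by (rule subset_trans[OF keys_rat_scale assms(2)[OF subsetD[OF assms(1) that]]])
  then show ?thesis
    unfolding linear_extension_def by (intro subset_trans[OF keys_sum] UN_least)
qed

text \<open>A vector is the finite sum of its terms. Carrying the support bound along lets
  identities known only for indices in I spread to the whole carrier.\<close>

lemma basis_induct [consumes 1, case_names zero single add]:
  fixes x :: "'k \<Rightarrow>\<^sub>0 rat"
  assumes "Poly_Mapping.keys x \<subseteq> I"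
    and zero: "P 0"
    and single: "\<And>a c. a \<in> I \<Longrightarrow> P (Poly_Mapping.single a c)"
    and add: "\<And>x y. Poly_Mapping.keys x \<subseteq> I \<Longrightarrow> Poly_Mapping.keys y \<subseteq> I \<Longrightarrow>
      P x \<Longrightarrow> P y \<Longrightarrow> P (x + y)"
  shows "P x"
proof -
  have "P (\<Sum>a\<in>A. Poly_Mapping.single a (Poly_Mapping.lookup x a))"
    if "finite A" "A \<subseteq> I" for A
    using that
  proof (induction A rule: finite_induct)
    case (insert a A)
    \<comment> \<open>The rule \<open>add\<close> asks for the support of the partial sum to lie in
      I.\<close>
    have "Poly_Mapping.keys (\<Sum>a\<in>A. Poly_Mapping.single a (Poly_Mapping.lookup x a)) \<subseteq> A"
      using keys_sum[of "\<lambda>a. Poly_Mapping.single a (Poly_Mapping.lookup x a)" A]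
      by (auto split: if_splits)
    then show ?case using insert by (auto intro!: add single split: if_splits)
  qed (simp add: zero)
  from this[OF finite_keys assms(1)]
  have "P (\<Sum>a\<in>Poly_Mapping.keys x. Poly_Mapping.single a (Poly_Mapping.lookup x a))" .
  also have "(\<Sum>a\<in>Poly_Mapping.keys x. Poly_Mapping.single a (Poly_Mapping.lookup x a)) = x"
    by (rule poly_mapping_eqI)
      (auto simp: lookup_sum lookup_single when_def in_keys_iff)
  finally show ?thesis .
qed

section \<open>Based algebras\<close>

lemma based_algebra_simps [simp]:
  "carrier (based_algebra I p e) = {x. Poly_Mapping.keys x \<subseteq> I}"
  "\<one>\<^bsub>based_algebra I p e\<^esub> = Poly_Mapping.single e 1"
  "\<zero>\<^bsub>based_algebra I p e\<^esub> = 0"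
  "x \<oplus>\<^bsub>based_algebra I p e\<^esub> y = x + y"
  "c \<odot>\<^bsub>based_algebra I p e\<^esub> x = rat_scale c x"
  by (simp_all add: based_algebra_def)

lemma based_algebra_mult:
  "x \<otimes>\<^bsub>based_algebra I p e\<^esub> y = linear_extension (\<lambda>a. linear_extension (p a) y) x"
  by (simp add: based_algebra_def linear_extension_def rat_scale_sum)

lemma based_algebra_mult_single:
  "Poly_Mapping.single a c \<otimes>\<^bsub>based_algebra I p e\<^esub> Poly_Mapping.single b d =
    rat_scale (c * d) (p a b)"
  by (simp add: based_algebra_mult)

lemma based_algebra_bilinear:
  "(x + y) \<otimes>\<^bsub>based_algebra I p e\<^esub> z =
    x \<otimes>\<^bsub>based_algebra I p e\<^esub> z + y \<otimes>\<^bsub>based_algebra I p e\<^esub> z"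
  "z \<otimes>\<^bsub>based_algebra I p e\<^esub> (x + y) =
    z \<otimes>\<^bsub>based_algebra I p e\<^esub> x + z \<otimes>\<^bsub>based_algebra I p e\<^esub> y"
  "rat_scale c x \<otimes>\<^bsub>based_algebra I p e\<^esub> y = rat_scale c (x \<otimes>\<^bsub>based_algebra I p e\<^esub> y)"
  "x \<otimes>\<^bsub>based_algebra I p e\<^esub> rat_scale c y = rat_scale c (x \<otimes>\<^bsub>based_algebra I p e\<^esub> y)"
  "0 \<otimes>\<^bsub>based_algebra I p e\<^esub> y = 0"
  "x \<otimes>\<^bsub>based_algebra I p e\<^esub> 0 = 0"
  by (simp_all add: based_algebra_mult linear_extension_add linear_extension_scale
      linear_extension_add_fun linear_extension_scale_fun)

text \<open>By bilinearity the algebra laws need checking on basis vectors only. Associativity is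
  phrased with full products because \<open>p a b\<close> may be any combination of basis
  vectors.\<close>

lemma rat_algebra_based_algebra:
  fixes p :: "'k \<Rightarrow> 'k \<Rightarrow> 'k \<Rightarrow>\<^sub>0 rat"
  assumes e: "e \<in> I"
    and closed: "\<And>a b. a \<in> I \<Longrightarrow> b \<in> I \<Longrightarrow> Poly_Mapping.keys (p a b) \<subseteq> I"
    and unit: "\<And>a. a \<in> I \<Longrightarrow> p e a = Poly_Mapping.single a 1"
      "\<And>a. a \<in> I \<Longrightarrow> p a e = Poly_Mapping.single a 1"
    and assoc: "\<And>a b c. a \<in> I \<Longrightarrow> b \<in> I \<Longrightarrow> c \<in> I \<Longrightarrow>
      p a b \<otimes>\<^bsub>based_algebra I p e\<^esub> Poly_Mapping.single c 1 =
      Poly_Mapping.single a 1 \<otimes>\<^bsub>based_algebra I p e\<^esub> p b c"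
  shows "rat_algebra (based_algebra I p e)"
proof -
  let ?A = "based_algebra I p e"
  have mult_closed: "Poly_Mapping.keys (x \<otimes>\<^bsub>?A\<^esub> y) \<subseteq> I"
    if "Poly_Mapping.keys x \<subseteq> I" "Poly_Mapping.keys y \<subseteq> I" for x y
    unfolding based_algebra_mult
    by (rule keys_linear_extension[OF that(1)], rule keys_linear_extension[OF that(2)],
        rule closed)
  have assoc': "(x \<otimes>\<^bsub>?A\<^esub> y) \<otimes>\<^bsub>?A\<^esub> z = x \<otimes>\<^bsub>?A\<^esub> (y \<otimes>\<^bsub>?A\<^esub> z)"
    if x: "Poly_Mapping.keys x \<subseteq> I" and y: "Poly_Mapping.keys y \<subseteq> I"
      and z: "Poly_Mapping.keys z \<subseteq> I" for x y z
    using x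
  \<comment> \<open>Nested inductions reduce the three factors in turn to multiples of basis
    vectors.\<close>
  proof (induction x rule: basis_induct)
    case (single a r)
    show ?case using y
    proof (induction y rule: basis_induct)
      case (single b s)
      show ?case using z
      proof (induction z rule: basis_induct)
        case (single c t)
        \<comment> \<open>Splitting off the scalars lets bilinearity pull r, s and t out of both
          bracketings, leaving \<open>assoc\<close>.\<close>
        have *: "Poly_Mapping.single i u = rat_scale u (Poly_Mapping.single i 1)" for i :: 'k and u
          by simp
        show ?case
          using assoc[OF \<open>a \<in> I\<close> \<open>b \<in> I\<close> \<open>c \<in> I\<close>]
          by (simp only: *[of _ r] *[of _ s] *[of _ t] based_algebra_bilinear
              based_algebra_mult_single rat_scale_rat_scale mult_1_right rat_scale_one
              mult.assoc mult.commute mult.left_commute)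
      qed (simp_all add: based_algebra_bilinear)
    qed (simp_all add: based_algebra_bilinear)
  qed (simp_all add: based_algebra_bilinear)
  have left: "Poly_Mapping.single e 1 \<otimes>\<^bsub>?A\<^esub> x = x" if "Poly_Mapping.keys x \<subseteq> I" for x
    using that
    by (induction x rule: basis_induct)
      (simp_all add: based_algebra_bilinear based_algebra_mult_single unit)
  have right: "x \<otimes>\<^bsub>?A\<^esub> Poly_Mapping.single e 1 = x" if "Poly_Mapping.keys x \<subseteq> I" for x
    using that
    by (induction x rule: basis_induct)
      (simp_all add: based_algebra_bilinear based_algebra_mult_single unit)
  have add_closed: "Poly_Mapping.keys (x + y) \<subseteq> I"
    if "Poly_Mapping.keys x \<subseteq> I" "Poly_Mapping.keys y \<subseteq> I" for x y :: "'k \<Rightarrow>\<^sub>0 rat"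
    using that keys_add[of x y] by blast
  have scale_closed: "Poly_Mapping.keys (rat_scale c x) \<subseteq> I"
    if "Poly_Mapping.keys x \<subseteq> I" for x and c
    by (rule subset_trans[OF keys_rat_scale that])
  have group: "abelian_group ?A"
  proof (rule abelian_groupI)
    fix x assume "x \<in> carrier ?A"
    then show "\<exists>y\<in>carrier ?A. y \<oplus>\<^bsub>?A\<^esub> x = \<zero>\<^bsub>?A\<^esub>"
      by (intro bexI[of _ "- x"]) auto
  qed (auto simp: add_closed algebra_simps)
  have "Module.module rat_ring ?A"
    by (rule moduleI)
      (auto simp: group scale_closed rat_scale_add rat_scale_add_left rat_scale_one
        ring_of_type_algebra_def[where 'a = rat]
        intro: cring_from_type_algebra[unfolded ring_of_type_algebra_def])
  moreover have "Ring.ring ?A"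
    by (rule ringI)
      (auto simp: group e mult_closed assoc' left right based_algebra_bilinear
        intro!: monoidI)
  ultimately show ?thesis
    by (simp add: rat_algebra_def based_algebra_bilinear)
qed

section \<open>Linear maps and isomorphisms between based algebras\<close>

lemma rat_linear_linear_extension:
  assumes "\<And>a. a \<in> I \<Longrightarrow> Poly_Mapping.keys (\<phi> a) \<subseteq> J"
  shows "rat_linear (based_algebra I p e) (based_algebra J q e') (linear_extension \<phi>)"
  using keys_linear_extension[of _ I \<phi> J] assms
  by (simp add: rat_linear_def linear_extension_add linear_extension_scale Pi_iff)

lemma rat_linear_eq_linear_extension:
  assumes f: "rat_linear (based_algebra I p e) (based_algebra J q e') f"
    and \<phi>: "\<And>a. a \<in> I \<Longrightarrow> f (Poly_Mapping.single a 1) = \<phi> a"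
    and "Poly_Mapping.keys x \<subseteq> I"
  shows "f x = linear_extension \<phi> x"
  using assms(3)
proof (induction x rule: basis_induct)
  case zero
  \<comment> \<open>\<open>rat_linear\<close> does not mention zero; homogeneity with scalar 0
    supplies f 0 = 0.\<close>
  have "f (rat_scale 0 0) = rat_scale 0 (f 0)"
    using f unfolding rat_linear_def by (metis based_algebra_simps(1,5) keys_zero
        empty_subsetI mem_Collect_eq)
  then show ?case by (simp add: linear_extension_def)
next
  case (single a c)
  have "f (rat_scale c (Poly_Mapping.single a 1)) = rat_scale c (f (Poly_Mapping.single a 1))"
    using f single by (simp add: rat_linear_def del: rat_scale_single)
  then show ?case using \<phi>[OF single] by simp
next
  case (add x y)
  then show ?case using f by (simp add: rat_linear_def linear_extension_add)
qed

text \<open>Relabelling a basis bijectively and rescaling by nonzero factors is invertible: relabel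
  back and divide. Multiplicativity then reduces to pairs of basis vectors.\<close>

lemma rat_algebra_iso_monomial:
  assumes A: "rat_algebra (based_algebra I p e)" and B: "rat_algebra (based_algebra J q e')"
    and f: "rat_linear (based_algebra I p e) (based_algebra J q e') f"
    and f_single: "\<And>a. a \<in> I \<Longrightarrow> f (Poly_Mapping.single a 1) = Poly_Mapping.single (h a) (v a)"
    and h: "bij_betw h I J" and v: "\<And>a. a \<in> I \<Longrightarrow> v a \<noteq> 0"
    and e: "e \<in> I" "h e = e'" "v e = 1"
    and closed: "\<And>a b. a \<in> I \<Longrightarrow> b \<in> I \<Longrightarrow> Poly_Mapping.keys (p a b) \<subseteq> I"
    and mult: "\<And>a b. a \<in> I \<Longrightarrow> b \<in> I \<Longrightarrow>
      f (p a b) = rat_scale (v a * v b) (q (h a) (h b))"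
  shows "rat_algebra_iso (based_algebra I p e) (based_algebra J q e') f"
proof -
  let ?A = "based_algebra I p e" and ?B = "based_algebra J q e'"
  \<comment> \<open>F is linear on all finitely supported functions, whereas f is constrained only
    on the carrier; the computations use F and return to f through \<open>fF\<close>.\<close>
  define F where "F = linear_extension (\<lambda>a. Poly_Mapping.single (h a) (v a))"
  define g where "g = inv_into I h"
  define G where "G = linear_extension (\<lambda>b. Poly_Mapping.single (g b) (1 / v (g b)))"
  have fF: "f x = F x" if "Poly_Mapping.keys x \<subseteq> I" for x
    unfolding F_def using f f_single that by (rule rat_linear_eq_linear_extension)
  have hJ: "h a \<in> J" and gh: "g (h a) = a" if "a \<in> I" for a
    using h that by (auto simp: g_def bij_betw_def)
  have gI: "g b \<in> I" and hg: "h (g b) = b" if "b \<in> J" for b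
    using h that by (auto simp: g_def bij_betw_def inv_into_into f_inv_into_f)
  have F_keys: "Poly_Mapping.keys (F x) \<subseteq> J" if "Poly_Mapping.keys x \<subseteq> I" for x
    unfolding F_def using that by (rule keys_linear_extension) (simp add: hJ)
  have G_keys: "Poly_Mapping.keys (G x) \<subseteq> I" if "Poly_Mapping.keys x \<subseteq> J" for x
    unfolding G_def using that by (rule keys_linear_extension) (simp add: gI)
  have GF: "G (F x) = x" if "Poly_Mapping.keys x \<subseteq> I" for x
    using that
    by (induction x rule: basis_induct)
      (simp_all add: F_def G_def linear_extension_add gh v)
  have FG: "F (G x) = x" if "Poly_Mapping.keys x \<subseteq> J" for x
    using that
    by (induction x rule: basis_induct)
      (simp_all add: F_def G_def linear_extension_add hg gI v)
  have "bij_betw F (carrier ?A) (carrier ?B)"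
    by (rule bij_betw_byWitness[of _ G]) (auto simp: GF FG dest: F_keys G_keys)
  then have "bij_betw f (carrier ?A) (carrier ?B)"
    by (subst bij_betw_cong[of _ f F]) (simp_all add: fF)
  moreover have "f \<in> ring_hom ?A ?B"
  proof (rule ring_hom_memI)
    fix x y assume x: "x \<in> carrier ?A" and y: "y \<in> carrier ?A"
    have xy: "x \<otimes>\<^bsub>?A\<^esub> y \<in> carrier ?A"
      using A x y by (simp add: rat_algebra_def monoid.m_closed ring.is_monoid del: based_algebra_simps)
    have "F (x \<otimes>\<^bsub>?A\<^esub> y) = F x \<otimes>\<^bsub>?B\<^esub> F y"
      using x[simplified]
    proof (induction x rule: basis_induct)
      case zero
      then show ?case by (simp add: based_algebra_bilinear) (simp add: F_def based_algebra_bilinear)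
    next
      case (add x x')
      then show ?case
        by (simp add: based_algebra_bilinear) (simp add: F_def linear_extension_add
          based_algebra_bilinear)
    next
      case (single a c)
      show ?case using y[simplified]
      proof (induction y rule: basis_induct)
        case zero
        then show ?case by (simp add: based_algebra_bilinear) (simp add: F_def based_algebra_bilinear)
      next
        case (add y y')
        then show ?case
          by (simp add: based_algebra_bilinear) (simp add: F_def linear_extension_add
            based_algebra_bilinear)
      next
        case (single b d)
        have "F (p a b) = rat_scale (v a * v b) (q (h a) (h b))"
          using mult[OF \<open>a \<in> I\<close> \<open>b \<in> I\<close>] fF[OF closed[OF \<open>a \<in> I\<close> \<open>b \<in> I\<close>]] by simp
        then show ?case
          by (simp add: based_algebra_mult_single F_def linear_extension_scale mult_ac)
      qed
    qed
    then show "f (x \<otimes>\<^bsub>?A\<^esub> y) = f x \<otimes>\<^bsub>?B\<^esub> f y"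
      using fF x y xy by simp
  qed (use f e f_single in \<open>auto simp: rat_linear_def\<close>)
  ultimately show ?thesis
    using A B f by (simp add: rat_algebra_iso_def ring_iso_def)
qed

section \<open>Sorted shifted shuffles\<close>

lemma length_shift [simp]: "length (shift n \<beta>) = length \<beta>"
  by (simp add: shift_def)

lemma shift_Nil [simp]: "shift n [] = []"
  by (simp add: shift_def)

lemma shift_0 [simp]: "shift 0 \<beta> = \<beta>"
  by (simp add: shift_def)

lemma shift_append: "shift n (\<alpha> @ \<beta>) = shift n \<alpha> @ shift n \<beta>"
  by (simp add: shift_def)

lemma shift_shift: "shift n (shift m \<beta>) = shift (m + n) \<beta>"
  by (simp add: shift_def add.assoc)

section \<open>Parking functions under sorting, shifting and shuffling\<close>

lemma Nil_PF [simp]: "[] \<in> PF"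
  by (simp add: PF_def)

lemma PF_sort [simp]: "sort \<alpha> \<in> PF \<longleftrightarrow> \<alpha> \<in> PF"
  by (simp add: PF_def sorted_sort_id)

lemma PF_le_length:
  assumes "\<alpha> \<in> PF" "a \<in> set \<alpha>"
  shows "a \<le> length \<alpha>"
proof -
  obtain i where "i < length \<alpha>" "sort \<alpha> ! i = a"
    using assms(2) by (metis in_set_conv_nth length_sort set_sort)
  then show ?thesis using assms(1) by (fastforce simp: PF_def)
qed

lemma sort_shift: "sort (shift n \<beta>) = shift n (sort \<beta>)"
  by (rule properties_for_sort) (auto simp: shift_def sorted_wrt_map intro: sorted_wrt_mono_rel)

text \<open>Letters of \<alpha> are at most its length; letters of \<beta> are positive, so after
  the shift they exceed it.\<close>

lemma PF_disjoint_shift: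
  assumes "\<alpha> \<in> PF" "\<beta> \<in> PF"
  shows "set \<alpha> \<inter> set (shift (length \<alpha>) \<beta>) = {}"
  using assms PF_le_length[OF assms(1)] by (fastforce simp: PF_def shift_def)

lemma sort_shifted_append:
  assumes "\<alpha> \<in> PF"
  shows "sort (\<alpha> @ shift (length \<alpha>) \<beta>) = sort \<alpha> @ shift (length \<alpha>) (sort \<beta>)"
  unfolding sort_shift[symmetric]
  by (rule sort_append) (auto simp: shift_def dest: PF_le_length[OF assms])

lemma PF_shifted_append:
  assumes "\<alpha> \<in> PF" "\<beta> \<in> PF"
  shows "\<alpha> @ shift (length \<alpha>) \<beta> \<in> PF"
proof -
  have "sort (\<alpha> @ shift (length \<alpha>) \<beta>) ! i \<le> i + 1"
    if "i < length \<alpha> + length \<beta>" for i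
  proof (cases "i < length \<alpha>")
    case False
    \<comment> \<open>Past the first block, index and letter are both raised by
      \<open>length \<alpha>\<close>, so the bound for \<beta> carries over.\<close>
    then have "sort \<beta> ! (i - length \<alpha>) \<le> (i - length \<alpha>) + 1"
      using assms(2) that by (simp add: PF_def)
    then show ?thesis
      using False that by (simp add: sort_shifted_append[OF assms(1)] nth_append shift_def[of _ "sort \<beta>"])
  qed (use assms(1) in \<open>simp add: sort_shifted_append[OF assms(1)] nth_append PF_def\<close>)
  then show ?thesis using assms by (auto simp: PF_def shift_def)
qed

lemma sort_shifted_shuffles:
  assumes "\<alpha> \<in> PF" "\<gamma> \<in> shifted_shuffles \<alpha> \<beta>"
  shows "sort \<gamma> = sort \<alpha> @ shift (length \<alpha>) (sort \<beta>)"
proof -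
  have "mset \<gamma> = mset (\<alpha> @ shift (length \<alpha>) \<beta>)"
    using assms(2) by (simp add: shifted_shuffles_def mset_shuffles)
  then have "sort \<gamma> = sort (\<alpha> @ shift (length \<alpha>) \<beta>)"
    by (metis sorted_list_of_multiset_mset)
  then show ?thesis by (simp add: sort_shifted_append[OF assms(1)])
qed

text \<open>With disjoint alphabets a shuffle amounts to the choice of the positions taken by
  \<alpha>.\<close>

lemma card_shifted_shuffles:
  assumes "\<alpha> \<in> PF" "\<beta> \<in> PF"
  shows "card (shifted_shuffles \<alpha> \<beta>) = (length \<alpha> + length \<beta>) choose length \<alpha>"
  using card_disjoint_shuffles[OF PF_disjoint_shift[OF assms]] by (simp add: shifted_shuffles_def)

text \<open>All shuffles have the same image, so the multiset is one word repeated; the word and its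
  multiplicity depend only on the lengths and sorted words.\<close>

lemma weakly_shuffle_compatible_sort: "weakly_shuffle_compatible (sort :: nat list \<Rightarrow> nat list)"
proof -
  have "image_mset sort (mset_set (shifted_shuffles \<alpha> \<beta>)) =
      replicate_mset ((length \<alpha> + length \<beta>) choose length \<alpha>)
        (sort \<alpha> @ shift (length \<alpha>) (sort \<beta>))"
    if "\<alpha> \<in> PF" "\<beta> \<in> PF" for \<alpha> \<beta>
  proof -
    have "image_mset sort (mset_set (shifted_shuffles \<alpha> \<beta>)) =
      image_mset (\<lambda>_. sort \<alpha> @ shift (length \<alpha>) (sort \<beta>)) (mset_set (shifted_shuffles \<alpha> \<beta>))"
      by (rule image_mset_cong)
        (metis sort_shifted_shuffles[OF that(1)] elem_mset_set finite_shuffles shifted_shuffles_def)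
    then show ?thesis
      by (simp add: image_mset_const_eq card_shifted_shuffles[OF that])
  qed
  then show ?thesis by (simp add: weakly_shuffle_compatible_def)
qed

section \<open>The two algebras\<close>

lemma PF_class_sort_eq:
  assumes "sort \<alpha> = sort \<beta>"
  shows "PF_class sort \<alpha> = PF_class sort \<beta>"
proof -
  have "length \<alpha> = length \<beta>" using assms by (metis length_sort)
  then show ?thesis using assms by (simp add: PF_class_def)
qed

lemma some_PF_class_sort:
  assumes "\<alpha> \<in> PF"
  shows "(SOME \<beta>. \<beta> \<in> PF_class sort \<alpha>) \<in> PF"
    "sort (SOME \<beta>. \<beta> \<in> PF_class sort \<alpha>) = sort \<alpha>"
    "length (SOME \<beta>. \<beta> \<in> PF_class sort \<alpha>) = length \<alpha>"
  using someI[of "\<lambda>\<beta>. \<beta> \<in> PF_class sort \<alpha>" \<alpha>] assms by (simp_all add: PF_class_def)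

lemma sum_PF_basis_shifted_shuffles:
  assumes "\<alpha> \<in> PF" "\<beta> \<in> PF"
  shows "(\<Sum>\<gamma>\<in>shifted_shuffles \<alpha> \<beta>. PF_basis sort \<gamma>) =
    Poly_Mapping.single (PF_class sort (\<alpha> @ shift (length \<alpha>) \<beta>))
      (fact (length \<alpha> + length \<beta>) / (fact (length \<alpha>) * fact (length \<beta>)))"
    (is "_ = Poly_Mapping.single ?C ?c")
proof -
  have "PF_basis sort \<gamma> = Poly_Mapping.single ?C 1" if "\<gamma> \<in> shifted_shuffles \<alpha> \<beta>" for \<gamma>
    unfolding PF_basis_def
    using PF_class_sort_eq[of \<gamma> "\<alpha> @ shift (length \<alpha>) \<beta>"]
      sort_shifted_shuffles[OF assms(1) that] sort_shifted_append[OF assms(1)] by simp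
  then have "(\<Sum>\<gamma>\<in>shifted_shuffles \<alpha> \<beta>. PF_basis sort \<gamma>) =
      (\<Sum>\<gamma>\<in>shifted_shuffles \<alpha> \<beta>. Poly_Mapping.single ?C 1)"
    by simp
  also have "\<dots> = Poly_Mapping.single ?C (of_nat (card (shifted_shuffles \<alpha> \<beta>)))"
    by (rule poly_mapping_eqI) (simp add: lookup_sum lookup_single when_def)
  \<comment> \<open>Factorials replace the binomial coefficient so that they can cancel against the
    factors of the isomorphism.\<close>
  also have "(of_nat (card (shifted_shuffles \<alpha> \<beta>)) :: rat) = ?c"
    by (simp add: card_shifted_shuffles[OF assms] binomial_fact)
  finally show ?thesis .
qed

text \<open>Repeats the structure constants of \<open>PF_algebra\<close> literally, so that
  unfolding it matches the lemmas below.\<close>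

abbreviation sort_product ::
  "nat list set \<Rightarrow> nat list set \<Rightarrow> nat list set \<Rightarrow>\<^sub>0 rat" where
  "sort_product C D \<equiv>
    \<Sum>\<gamma>\<in>shifted_shuffles (SOME \<alpha>. \<alpha> \<in> C) (SOME \<beta>. \<beta> \<in> D). PF_basis sort \<gamma>"

text \<open>The chosen representatives may differ from \<alpha> and \<beta>, but they share their
  lengths and sorted words, which determine the right-hand side.\<close>

lemma sort_product_PF_class:
  assumes "\<alpha> \<in> PF" "\<beta> \<in> PF"
  shows "sort_product (PF_class sort \<alpha>) (PF_class sort \<beta>) =
    Poly_Mapping.single (PF_class sort (\<alpha> @ shift (length \<alpha>) \<beta>))
      (fact (length \<alpha> + length \<beta>) / (fact (length \<alpha>) * fact (length \<beta>)))"
proof -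
  define \<alpha>' where "\<alpha>' = (SOME \<gamma>. \<gamma> \<in> PF_class sort \<alpha>)"
  define \<beta>' where "\<beta>' = (SOME \<gamma>. \<gamma> \<in> PF_class sort \<beta>)"
  note \<alpha>' = some_PF_class_sort[OF assms(1), folded \<alpha>'_def]
  note \<beta>' = some_PF_class_sort[OF assms(2), folded \<beta>'_def]
  have "PF_class sort (\<alpha>' @ shift (length \<alpha>) \<beta>') = PF_class sort (\<alpha> @ shift (length \<alpha>) \<beta>)"
    using sort_shifted_append[OF \<alpha>'(1), of \<beta>'] sort_shifted_append[OF assms(1), of \<beta>] \<alpha>' \<beta>'
    by (intro PF_class_sort_eq) simp
  then show ?thesis
    using sum_PF_basis_shifted_shuffles[OF \<alpha>'(1) \<beta>'(1)] \<alpha>'(3) \<beta>'(3)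
    by (simp add: \<alpha>'_def[symmetric] \<beta>'_def[symmetric])
qed

text \<open>For lengths n, m, k both bracketings of a triple product give the class of the
  concatenation with shifts 0, n, n + m and the coefficient (n + m + k)! / (n! m! k!).\<close>

lemma rat_algebra_PF_algebra_sort: "rat_algebra (PF_algebra sort)"
  unfolding PF_algebra_def
proof (rule rat_algebra_based_algebra)
  fix C D E
  assume "C \<in> PF_class sort ` PF" "D \<in> PF_class sort ` PF" "E \<in> PF_class sort ` PF"
  then show "sort_product C D
      \<otimes>\<^bsub>based_algebra (PF_class sort ` PF) sort_product (PF_class sort [])\<^esub>
        Poly_Mapping.single E 1 =
      Poly_Mapping.single C 1
      \<otimes>\<^bsub>based_algebra (PF_class sort ` PF) sort_product (PF_class sort [])\<^esub>
        sort_product D E"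
    by (auto simp: sort_product_PF_class PF_shifted_append based_algebra_mult_single
        shift_append shift_shift ac_simps)
next
  fix C
  assume "C \<in> PF_class sort ` PF"
  then obtain \<alpha> where \<alpha>: "\<alpha> \<in> PF" "C = PF_class sort \<alpha>" by blast
  show "sort_product (PF_class sort []) C = Poly_Mapping.single C 1"
    "sort_product C (PF_class sort []) = Poly_Mapping.single C 1"
    using sort_product_PF_class[OF Nil_PF \<alpha>(1)] sort_product_PF_class[OF \<alpha>(1) Nil_PF] \<alpha>(2)
    by simp_all
qed (auto simp: sort_product_PF_class PF_shifted_append)

text \<open>The concatenation equals its own sorted form.\<close>

lemma sorted_shifted_append:
  assumes "\<alpha> \<in> PF" "sorted \<alpha>" "sorted \<beta>"
  shows "sorted (\<alpha> @ shift (length \<alpha>) \<beta>)"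
  using sort_shifted_append[OF assms(1), of \<beta>] assms(2,3) sorted_sort_id
  by (metis sorted_sort)

lemma rat_algebra_CQSym: "rat_algebra CQSym"
  unfolding CQSym_def
  by (rule rat_algebra_based_algebra)
    (auto simp: CQ_basis_def PF_shifted_append sorted_shifted_append based_algebra_mult_single
      shift_append shift_shift add.commute)

lemma rat_algebra_iso_sort:
  assumes f: "rat_linear (PF_algebra sort) CQSym f"
    and basis: "\<And>\<alpha>. \<alpha> \<in> PF \<Longrightarrow>
      f (PF_basis sort \<alpha>) = (1 / fact (length \<alpha>)) \<odot>\<^bsub>CQSym\<^esub> CQ_basis (sort \<alpha>)"
  shows "rat_algebra_iso (PF_algebra sort) CQSym f"
proof -
  define h :: "nat list set \<Rightarrow> nat list" where "h C = sort (SOME \<alpha>. \<alpha> \<in> C)" for C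
  define v :: "nat list set \<Rightarrow> rat" where "v C = 1 / fact (length (SOME \<alpha>. \<alpha> \<in> C))" for C
  have h: "h (PF_class sort \<alpha>) = sort \<alpha>" and v: "v (PF_class sort \<alpha>) = 1 / fact (length \<alpha>)"
    if "\<alpha> \<in> PF" for \<alpha>
    using some_PF_class_sort[OF that] by (simp_all add: h_def v_def)
  have f_class: "f (Poly_Mapping.single (PF_class sort \<alpha>) 1) =
      Poly_Mapping.single (sort \<alpha>) (1 / fact (length \<alpha>))" if "\<alpha> \<in> PF" for \<alpha>
    using basis[OF that] by (simp add: PF_basis_def CQ_basis_def CQSym_def)
  have f_scale: "f (Poly_Mapping.single (PF_class sort \<alpha>) c) =
      Poly_Mapping.single (sort \<alpha>) (c / fact (length \<alpha>))" if "\<alpha> \<in> PF" for \<alpha> c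
  proof -
    have "f (rat_scale c (Poly_Mapping.single (PF_class sort \<alpha>) 1)) =
        rat_scale c (f (Poly_Mapping.single (PF_class sort \<alpha>) 1))"
      using f that by (simp add: rat_linear_def PF_algebra_def CQSym_def del: rat_scale_single)
    then show ?thesis using f_class[OF that] by simp
  qed
  \<comment> \<open>Each class contains exactly one weakly increasing word, so
    \<open>PF_class sort\<close> inverts h.\<close>
  have bij: "bij_betw h (PF_class sort ` PF) {\<alpha> \<in> PF. sorted \<alpha>}"
    by (rule bij_betw_byWitness[of _ "PF_class sort"])
      (auto simp: h sorted_sort_id PF_class_sort_eq[of "sort a" a for a])
  show ?thesis
    unfolding PF_algebra_def CQSym_def
  proof (rule rat_algebra_iso_monomial[where h = h and v = v])
    fix C D assume "C \<in> PF_class sort ` PF" "D \<in> PF_class sort ` PF"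
    \<comment> \<open>The structure constant (n + m)! / (n! m!) times the factor 1 / (n + m)! of the
      product class is (1 / n!) (1 / m!), that is, \<open>v C * v D\<close>.\<close>
    then show "f (sort_product C D) =
        rat_scale (v C * v D) (CQ_basis (h C @ shift (length (h C)) (h D)))"
      by (auto simp: sort_product_PF_class h v f_scale PF_shifted_append sort_shifted_append
          CQ_basis_def)
  qed (use f rat_algebra_PF_algebra_sort rat_algebra_CQSym in
      \<open>auto simp: PF_algebra_def CQSym_def h v f_class sort_product_PF_class PF_shifted_append
        intro: bij\<close>)
qed

text \<open>Linearity and the values on classes fix f only on the carrier. Hence the isomorphism
  claim ranges over all such f, and the existence claim keeps it from being vacuous.\<close>

theorem theorem4p16:
  shows "weakly_shuffle_compatible (sort :: nat list \<Rightarrow> nat list) \<and>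
    (\<exists>f. rat_linear (PF_algebra sort) CQSym f \<and>
      (\<forall>\<alpha>\<in>PF. f (PF_basis sort \<alpha>) = (1 / fact (length \<alpha>)) \<odot>\<^bsub>CQSym\<^esub> CQ_basis (sort \<alpha>))) \<and>
    (\<forall>f. rat_linear (PF_algebra sort) CQSym f \<and>
      (\<forall>\<alpha>\<in>PF. f (PF_basis sort \<alpha>) = (1 / fact (length \<alpha>)) \<odot>\<^bsub>CQSym\<^esub> CQ_basis (sort \<alpha>)) \<longrightarrow>
      rat_algebra_iso (PF_algebra sort) CQSym f)"
proof (intro conjI allI impI)
  \<comment> \<open>A representative is chosen from each class; its sorted word and length do not
    depend on the choice.\<close>
  define \<phi> :: "nat list set \<Rightarrow> nat list \<Rightarrow>\<^sub>0 rat" where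
    "\<phi> C = (let \<alpha> = SOME \<alpha>. \<alpha> \<in> C in Poly_Mapping.single (sort \<alpha>) (1 / fact (length \<alpha>)))" for C
  have \<phi>: "\<phi> (PF_class sort \<alpha>) = Poly_Mapping.single (sort \<alpha>) (1 / fact (length \<alpha>))"
    if "\<alpha> \<in> PF" for \<alpha>
    using some_PF_class_sort[OF that] by (simp add: \<phi>_def Let_def)
  have "rat_linear (PF_algebra sort) CQSym (linear_extension \<phi>)"
    unfolding PF_algebra_def CQSym_def
    by (rule rat_linear_linear_extension) (auto simp: \<phi>)
  moreover have "linear_extension \<phi> (PF_basis sort \<alpha>) =
      (1 / fact (length \<alpha>)) \<odot>\<^bsub>CQSym\<^esub> CQ_basis (sort \<alpha>)" if "\<alpha> \<in> PF" for \<alpha>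
    by (simp add: PF_basis_def \<phi>[OF that] CQSym_def CQ_basis_def rat_scale_one)
  ultimately show "\<exists>f. rat_linear (PF_algebra sort) CQSym f \<and>
      (\<forall>\<alpha>\<in>PF. f (PF_basis sort \<alpha>) = (1 / fact (length \<alpha>)) \<odot>\<^bsub>CQSym\<^esub> CQ_basis (sort \<alpha>))"
    by blast
qed (auto intro: weakly_shuffle_compatible_sort rat_algebra_iso_sort)

end
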